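(* Let $\chi$ be a probability distribution with constant (finite, independent of $n$ and $m$) support, and for $n\in\mathbb{N}$ let $\mathcal{D}=\chi^n$ be the product distribution. Let $0<c<1$ be a constant, let $(k_1,\dots,k_m)\leftarrow\mathcal{D}^m$ (i.e. $k_1,\dots,k_m$ are sampled independently from $\mathcal{D}$), and consider the multi-key guessing instance $(\mathcal{D},\mathbb{1}_{k_1},\dots,\mathbb{1}_{k_m})$ with parameter $c$. (1) If $c<\frac12$, then with probability at least $1-e^{-\Omega(m)}$ the algorithm MultiKeyGuess solves the instance with amortized cost per key $$T_{\mathsf{MKG}}=\widetilde{\mathcal{O}}\left(2^{\mathrm{H}(\chi)n}\right).$$ (2) If $\frac12\le c<1$, then with probability at least $1-e^{-\Omega(m)}$ the algorithm MultiKeyGuess solves the instance with amortized cost per key at most $2^{\mathrm{H}(\chi)n+\mathcal{O}(\sqrt n)}$, i.e. the cost increases at most by a subexponential factor $2^{\mathcal{O}(\sqrt n)}$. Here the constants hidden in $\Omega(\cdot)$, $\mathcal{O}(\cdot)$ and $\widetilde{\mathcal{O}}(\cdot)$ depend only on $\chi$ and $c$, $\widetilde{\mathcal{O}}$ suppresses factors polynomial in $n$, and the probability is over the choice of $k_1,\dots,k_m$.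
   Context: All logarithms are base 2. For a discrete distribution $\chi$ with support $A$ and probability mass function $P_\chi$, $\mathrm{H}(\chi)=-\sum_{a\in A}P_\chi(a)\log P_\chi(a)$ is the Shannon entropy. The product distribution $\chi^n$ on $A^n$ has mass function $P_{\chi^n}(a_1,\dots,a_n)=\prod_i P_\chi(a_i)$. For a key $k$ in the key space $\mathcal{K}$ (the support of $\mathcal{D}$), $\mathbb{1}_k:\mathcal{K}\to\{0,1\}$ is the oracle with $\mathbb{1}_k(x)=1$ iff $x=k$. Multi-key guessing problem with parameter $c$: given a description of $\mathcal{D}$ and oracle access to $\mathbb{1}_{k_1},\dots,\mathbb{1}_{k_m}$ for $(k_1,\dots,k_m)\leftarrow\mathcal{D}^m$, find a tuple $(k_1',\dots,k_m')\in(\mathcal{K}\cup\{\bot\})^m$ such that $k_i'=k_i$ for at least $cm$ indices $i$. Black-box access is assumed to an algorithm GetKey$_{\mathcal{D}}$ that on input $i\in\{1,\dots,|\mathcal{K}|\}$ outputs the $i$-th most likely key of $\mathcal{D}$ (ties broken by some fixed order). Algorithm AbortedKeyGuess$((\mathcal{D},\mathbb{1}_k),t)$: queries $\mathbb{1}_k$ on GetKey$_{\mathcal{D}}(1)$, GetKey$_{\mathcal{D}}(2)$, $\dots$ in this order; it returns the first $x$ with $\mathbb{1}_k(x)=1$ and returns $\bot$ if no such $x$ is found within the first $t$ trials. Algorithm MultiKeyGuess: start with $(k_1',\dots,k_m')=(\bot,\dots,\bot)$ and $t=1$. Repeat: set $t\leftarrow 2t$; for each $j\in\{1,\dots,m\}$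 set $k_j'\leftarrow$ AbortedKeyGuess$((\mathcal{D},\mathbb{1}_{k_j}),t)$; until $k_j'\neq\bot$ for at least $cm$ indices $j$. Output $(k_1',\dots,k_m')$. The cost of MultiKeyGuess is its total number of trials (calls to GetKey followed by an oracle query), and the amortized cost per key $T_{\mathsf{MKG}}$ is this total divided by $m$. *)

theory Defs
  imports "HOL-Probability.Probability" "HOL-Library.While_Combinator"
begin

definition shannon_entropy :: "'a pmf \<Rightarrow> real" where
  "shannon_entropy chi = - (\<Sum>a\<in>set_pmf chi. pmf chi a * log 2 (pmf chi a))"

text \<open>
  Tuples of length \<open>n\<close> are functions on \<open>{..<n}\<close> that are \<open>undefined\<close> elsewhere;
  the mass function on these is the product of the values of \<open>pmf chi\<close>, by \<open>pmf_Pi\<close>.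
\<close>

definition product_dist :: "nat \<Rightarrow> 'a pmf \<Rightarrow> (nat \<Rightarrow> 'a) pmf" where
  "product_dist n chi = Pi_pmf {..<n} undefined (\<lambda>_. chi)"

definition key_oracle :: "'k \<Rightarrow> 'k \<Rightarrow> bool" where
  "key_oracle k x \<longleftrightarrow> x = k"

text \<open>
  The enumerations of the (finite) support by non-increasing probability are exactly those
  arising from some choice of a fixed tie-breaking order. Indices start at 1; values outside
  \<open>{1..card (set_pmf D)}\<close> are left unspecified.
\<close>

definition is_get_key :: "'k pmf \<Rightarrow> (nat \<Rightarrow> 'k) \<Rightarrow> bool" where
  "is_get_key D getkey \<longleftrightarrow>
     bij_betw getkey {1..card (set_pmf D)} (set_pmf D) \<and>
     (\<forall>i\<in>{1..card (set_pmf D)}. \<forall>j\<in>{1..card (set_pmf D)}.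
        i \<le> j \<longrightarrow> pmf D (getkey j) \<le> pmf D (getkey i))"

lemma is_get_key_exists:
  fixes D :: "'k pmf"
  assumes "finite (set_pmf D)"
  shows "\<exists>getkey. is_get_key D getkey"
proof -
  obtain ys where ys: "set ys = set_pmf D" "distinct ys"
    using finite_distinct_list[OF assms] by blast
  define xs where "xs = sort_key (\<lambda>x. - pmf D x) ys"
  have xs: "set xs = set_pmf D" "distinct xs" "length xs = card (set_pmf D)"
    using ys by (auto simp: xs_def distinct_card[symmetric])
  have srt: "sorted (map (\<lambda>x. - pmf D x) xs)"
    unfolding xs_def by (rule sorted_sort_key)
  have b0: "bij_betw (\<lambda>i. i - 1) {1..length xs} {..<length xs}"
    by (rule bij_betw_byWitness[where f' = Suc]) auto
  have b1: "bij_betw ((!) xs) {..<length xs} (set xs)"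
    by (rule bij_betw_nth) (use xs in auto)
  have "bij_betw (\<lambda>i. xs ! (i - 1)) {1..length xs} (set xs)"
    using bij_betw_trans[OF b0 b1] by (simp add: comp_def)
  moreover have "pmf D (xs ! (j - 1)) \<le> pmf D (xs ! (i - 1))"
    if "i \<in> {1..length xs}" "j \<in> {1..length xs}" "i \<le> j" for i j
    using sorted_nth_mono[OF srt, of "i - 1" "j - 1"] that by auto
  ultimately have "is_get_key D (\<lambda>i. xs ! (i - 1))"
    unfolding is_get_key_def using xs by simp
  then show ?thesis by (rule exI[where x = "\<lambda>i. xs ! (i - 1)"])
qed

text \<open>
  \<open>key_guess_from getkey orc r i\<close> performs at most \<open>r\<close> trials, starting with the \<open>i\<close>-th most
  likely key. It returns the key found, or \<open>None\<close> for the failure symbol, together with the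
  number of trials made.
\<close>

primrec key_guess_from ::
  "(nat \<Rightarrow> 'k) \<Rightarrow> ('k \<Rightarrow> bool) \<Rightarrow> nat \<Rightarrow> nat \<Rightarrow> 'k option \<times> nat" where
  "key_guess_from getkey orc 0 i = (None, 0)"
| "key_guess_from getkey orc (Suc r) i =
     (if orc (getkey i) then (Some (getkey i), 1)
      else (let (x, q) = key_guess_from getkey orc r (Suc i) in (x, Suc q)))"

text \<open>
  For \<open>t\<close> larger than the size of the key space nothing is looked up beyond that size, provided
  the oracle belongs to a key in the key space: that key has been found by then.
\<close>

definition aborted_key_guess ::
  "(nat \<Rightarrow> 'k) \<Rightarrow> ('k \<Rightarrow> bool) \<Rightarrow> nat \<Rightarrow> 'k option \<times> nat" where
  "aborted_key_guess getkey orc t = key_guess_from getkey orc t 1"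

text \<open>The loop state consists of \<open>t\<close>, the current tuple, and the trials made so far.\<close>

type_synonym 'k mkg_state = "nat \<times> (nat \<Rightarrow> 'k option) \<times> nat"

definition mkg_round ::
  "(nat \<Rightarrow> 'k) \<Rightarrow> nat \<Rightarrow> (nat \<Rightarrow> 'k \<Rightarrow> bool) \<Rightarrow> 'k mkg_state \<Rightarrow> 'k mkg_state" where
  "mkg_round getkey m orcs = (\<lambda>(t, _, cost).
     (let t' = 2 * t;
          res = (\<lambda>j. aborted_key_guess getkey (orcs j) t')
      in (t', (\<lambda>j. if j < m then fst (res j) else None), cost + (\<Sum>j<m. snd (res j)))))"

definition mkg_done :: "real \<Rightarrow> nat \<Rightarrow> 'k mkg_state \<Rightarrow> bool" where
  "mkg_done c m = (\<lambda>(_, ks', _). real (card {j. j < m \<and> ks' j \<noteq> None}) \<ge> c * real m)"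

text \<open>
  A repeat-until loop: the body runs once before the first test. The result is \<open>None\<close> if the
  loop diverges, and otherwise the output tuple together with the total number of trials.
\<close>

definition multi_key_guess ::
  "(nat \<Rightarrow> 'k) \<Rightarrow> real \<Rightarrow> nat \<Rightarrow> (nat \<Rightarrow> 'k \<Rightarrow> bool) \<Rightarrow> ((nat \<Rightarrow> 'k option) \<times> nat) option" where
  "multi_key_guess getkey c m orcs =
     map_option snd
       (while_option (\<lambda>s. \<not> mkg_done c m s) (mkg_round getkey m orcs)
          (mkg_round getkey m orcs (1, (\<lambda>_. None), 0)))"

definition solves_multi_key ::
  "'k set \<Rightarrow> real \<Rightarrow> nat \<Rightarrow> (nat \<Rightarrow> 'k) \<Rightarrow> (nat \<Rightarrow> 'k option) \<Rightarrow> bool" where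
  "solves_multi_key K c m ks ks' \<longleftrightarrow>
     (\<forall>j<m. ks' j \<in> insert None (Some ` K)) \<and>
     real (card {j. j < m \<and> ks' j = Some (ks j)}) \<ge> c * real m"

definition mkg_succeeds_within ::
  "'k pmf \<Rightarrow> (nat \<Rightarrow> 'k) \<Rightarrow> real \<Rightarrow> nat \<Rightarrow> real \<Rightarrow> (nat \<Rightarrow> 'k) \<Rightarrow> bool" where
  "mkg_succeeds_within D getkey c m T ks \<longleftrightarrow>
     (\<exists>ks' cost. multi_key_guess getkey c m (\<lambda>j. key_oracle (ks j)) = Some (ks', cost) \<and>
        solves_multi_key (set_pmf D) c m ks ks' \<and> real cost / real m \<le> T)"

end

theory Submission imports Defs begin

text \<open>
  At most \<open>T\<close> keys have probability at least \<open>1/T\<close>, so each of them is found within \<open>T\<close> trials,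
  and by the doubling of \<open>t\<close> the amortized cost is at most \<open>4T\<close> as soon as \<open>cm\<close> of the sampled keys
  are that likely. By Hoeffding's inequality this fails with probability at most \<open>exp (-2 (q - c)\<^sup>2 m)\<close>
  if a single key is that likely with probability at least \<open>q > c\<close>. It remains to find \<open>T\<close> for
  \<open>\<chi>\<^sup>n\<close>, where \<open>- log P(k)\<close> is a sum of \<open>n\<close> independent variables with mean \<open>H(\<chi>)\<close>. For
  \<open>q < 1/2\<close> the central limit theorem allows \<open>log T = H(\<chi>) n\<close> for all large \<open>n\<close>, and a constant
  factor takes care of the small ones; for \<open>q < 1\<close> Hoeffding's inequality gives
  \<open>log T = H(\<chi>) n + O(sqrt n)\<close>.
\<close>

section \<open>Running the algorithm on a fixed tuple of keys\<close>

lemma snd_key_guess_from_le: "snd (key_guess_from g orc r i) \<le> r"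
  by (induction r arbitrary: i) (auto simp: case_prod_unfold Let_def)

lemma oracle_fst_key_guess_from: "fst (key_guess_from g orc r i) = Some x \<Longrightarrow> orc x"
  by (induction r arbitrary: i) (auto simp: case_prod_unfold Let_def split: if_splits)

lemma fst_key_guess_from_neq_None:
  "i \<le> j \<Longrightarrow> j < i + r \<Longrightarrow> orc (g j) \<Longrightarrow> fst (key_guess_from g orc r i) \<noteq> None"
proof (induction r arbitrary: i)
  case (Suc r)
  then show ?case
    by (cases "i = j") (auto simp: case_prod_unfold Let_def)
qed simp

text \<open>Once \<open>t \<ge> T\<close>, every key of index at most \<open>T\<close> has been
  found, so the test succeeds by \<open>early\<close>. As \<open>t\<close> doubles, it ends at no
  more than \<open>2 * T\<close>, and the limits of all rounds form a geometric sum of at most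
  \<open>2 * t\<close> per key.\<close>

lemma multi_key_guess_cost:
  fixes T c :: real
  assumes T: "T \<ge> 1"
    and early: "real (card {j. j < m \<and> (\<exists>i\<ge>1. real i \<le> T \<and> g i = ks j)}) \<ge> c * real m"
  shows "\<exists>ks' cost. multi_key_guess g c m (\<lambda>j. key_oracle (ks j)) = Some (ks', cost) \<and>
           (\<forall>j<m. ks' j \<in> {None, Some (ks j)}) \<and>
           real (card {j. j < m \<and> ks' j \<noteq> None}) \<ge> c * real m \<and>
           real cost \<le> 4 * T * real m"
proof -
  define orcs where "orcs = (\<lambda>j. key_oracle (ks j))"
  \<comment> \<open>A round with limit \<open>2 * t\<close> adds at most \<open>2 * t * m\<close>
    trials, which turns the bound \<open>2 * t * m\<close> into \<open>2 * (2 * t) * m\<close>. The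
    bound \<open>2 * T\<close> on \<open>t\<close> reflects that a round starts only from
    \<open>t \<le> T\<close>.\<close>
  define I where "I = (\<lambda>(t, ks', cost). real t \<le> 2 * T \<and> t \<ge> 1 \<and> cost \<le> 2 * t * m \<and>
    (\<forall>j<m. ks' j \<in> {None, Some (ks j)}) \<and>
    (\<forall>j<m. \<forall>i. 1 \<le> i \<and> i \<le> t \<and> g i = ks j \<longrightarrow> ks' j \<noteq> None))"
  \<comment> \<open>A round overwrites the tuple, so only bounds on \<open>t\<close> and
    \<open>cost\<close> are assumed of the old state. This also covers the first round, whose
    all-\<open>None\<close> tuple may violate \<open>I\<close>.\<close>
  have step: "I (mkg_round g m orcs (t, ks', cost))"
    if "real t \<le> T" "t \<ge> 1" "cost \<le> 2 * t * m" for t ks' cost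
  proof -
    have "(\<Sum>j<m. snd (aborted_key_guess g (orcs j) (2 * t))) \<le> (\<Sum>j<m. 2 * t)"
      unfolding aborted_key_guess_def by (intro sum_mono snd_key_guess_from_le)
    moreover have "fst (aborted_key_guess g (orcs j) (2 * t)) \<in> {None, Some (ks j)}" for j
      using oracle_fst_key_guess_from[of g "orcs j" "2 * t" 1]
      by (cases "fst (aborted_key_guess g (orcs j) (2 * t))")
         (auto simp: aborted_key_guess_def orcs_def key_oracle_def)
    moreover have "fst (aborted_key_guess g (orcs j) (2 * t)) \<noteq> None"
      if "1 \<le> i" "i \<le> 2 * t" "g i = ks j" for i j
      unfolding aborted_key_guess_def
      by (rule fst_key_guess_from_neq_None[of 1 i]) (use that in \<open>auto simp: orcs_def key_oracle_def\<close>)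
    ultimately show ?thesis
      using that by (auto simp: I_def mkg_round_def Let_def algebra_simps)
  qed
  \<comment> \<open>If \<open>t \<ge> T\<close>, the last clause of \<open>I\<close> yields an
    answer for each key counted in \<open>early\<close>, which is enough to stop.\<close>
  have undone: "real t < T" if "I (t, ks', cost)" "\<not> mkg_done c m (t, ks', cost)" for t ks' cost
  proof (rule ccontr)
    assume "\<not> real t < T"
    then have t: "T \<le> real t" by simp
    have "ks' j \<noteq> None" if "j < m" "1 \<le> i" "real i \<le> T" "g i = ks j" for i j
    proof -
      have "i \<le> t" using that t by linarith
      then show ?thesis using \<open>I (t, ks', cost)\<close> that unfolding I_def by blast
    qed
    then have "{j. j < m \<and> (\<exists>i\<ge>1. real i \<le> T \<and> g i = ks j)} \<subseteq> {j. j < m \<and> ks' j \<noteq> None}"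
      by blast
    then have "card {j. j < m \<and> (\<exists>i\<ge>1. real i \<le> T \<and> g i = ks j)} \<le> card {j. j < m \<and> ks' j \<noteq> None}"
      by (intro card_mono) auto
    with early have "mkg_done c m (t, ks', cost)"
      unfolding mkg_done_def by simp
    with that show False by simp
  qed
  define s where "s = mkg_round g m orcs (1, (\<lambda>_. None), 0)"
  have Is: "I s"
    unfolding s_def using T by (intro step) auto
  have Istep: "I (mkg_round g m orcs u)" if "I u" "\<not> mkg_done c m u" for u
  proof -
    obtain t ks' cost where u: "u = (t, ks', cost)" by (cases u)
    show ?thesis
      using undone[of t ks' cost] that unfolding u
      by (intro step) (auto simp: I_def)
  qed
  have "\<exists>u. while_option (\<lambda>s. \<not> mkg_done c m s) (mkg_round g m orcs) s = Some u"
  \<comment> \<open>An unfinished state has \<open>t < T\<close>, so the truncated difference is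
    positive; doubling \<open>t \<ge> 1\<close> lowers it.\<close>
  proof (rule measure_while_option_Some[where P = I and f = "\<lambda>(t, _). nat \<lceil>T\<rceil> - t"])
    fix u assume u: "I u" "\<not> mkg_done c m u"
    obtain t ks' cost where eq: "u = (t, ks', cost)" by (cases u)
    have "t < nat \<lceil>T\<rceil>" "t \<ge> 1"
      using undone[of t ks' cost] u unfolding eq by (auto simp: I_def; linarith)+
    then show "I (mkg_round g m orcs u) \<and>
        (case mkg_round g m orcs u of (t, _) \<Rightarrow> nat \<lceil>T\<rceil> - t) < (case u of (t, _) \<Rightarrow> nat \<lceil>T\<rceil> - t)"
      using Istep[OF u] by (auto simp: eq mkg_round_def Let_def)
  qed (rule Is)
  then obtain t ks' cost where u:
      "while_option (\<lambda>s. \<not> mkg_done c m s) (mkg_round g m orcs) s = Some (t, ks', cost)"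
    by (metis prod_cases3)
  have "I (t, ks', cost)"
    using while_option_rule[where P = I, OF Istep u Is] by simp
  moreover have "mkg_done c m (t, ks', cost)"
    using while_option_stop[OF u] by simp
  moreover have "real cost \<le> 4 * T * real m" if "I (t, ks', cost)"
  proof -
    have "cost \<le> 2 * t * m" and t: "real t \<le> 2 * T"
      using that by (auto simp: I_def)
    then have "real cost \<le> real (2 * t * m)"
      by (simp only: of_nat_le_iff)
    then have "real cost \<le> 2 * real t * real m"
      by simp
    also have "\<dots> \<le> 2 * (2 * T) * real m"
      using t by (intro mult_right_mono mult_left_mono) auto
    finally show ?thesis by simp
  qed
  ultimately show ?thesis
    using u unfolding multi_key_guess_def s_def orcs_def
    by (intro exI[of _ ks'] exI[of _ cost]) (auto simp: I_def mkg_done_def)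
qed

text \<open>The first \<open>i\<close> keys are all at least as likely as the \<open>i\<close>-th,
  so together they have mass at least \<open>i / T\<close>; as this is at most 1,
  \<open>i \<le> T\<close>.\<close>

lemma is_get_key_index_le:
  assumes g: "is_get_key D g" and fin: "finite (set_pmf D)"
    and T: "T > 0" and k: "1 / T \<le> pmf D k"
  shows "\<exists>i\<ge>1. real i \<le> T \<and> g i = k"
proof -
  have "0 < 1 / T"
    using T by simp
  then have "k \<in> set_pmf D"
    using k by (metis order_less_le_trans pmf_positive_iff)
  then obtain i where i: "i \<in> {1..card (set_pmf D)}" "g i = k"
    using g unfolding is_get_key_def bij_betw_def by (metis imageE)
  have sub: "{1..i} \<subseteq> {1..card (set_pmf D)}"
    using i by auto
  have inj: "inj_on g {1..i}"
    using g sub unfolding is_get_key_def bij_betw_def by (metis inj_on_subset)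
  have "real i * (1 / T) = (\<Sum>j\<in>{1..i}. 1 / T)"
    by simp
  also have "\<dots> \<le> (\<Sum>j\<in>{1..i}. pmf D (g j))"
  proof (rule sum_mono)
    fix j assume "j \<in> {1..i}"
    then have "pmf D (g i) \<le> pmf D (g j)"
      using g sub i unfolding is_get_key_def by (metis atLeastAtMost_iff subsetD)
    then show "1 / T \<le> pmf D (g j)"
      using k i by simp
  qed
  also have "\<dots> = sum (pmf D) (g ` {1..i})"
    by (simp only: sum.reindex[OF inj] comp_def)
  also have "\<dots> = measure_pmf.prob D (g ` {1..i})"
    by (simp add: measure_measure_pmf_finite)
  also have "\<dots> \<le> 1"
    by simp
  finally show ?thesis
    using i T by (auto simp: field_simps)
qed

lemma mkg_succeeds_within_of_likely_keys:
  assumes g: "is_get_key D g" and fin: "finite (set_pmf D)"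
    and T: "T \<ge> 1" and m: "m \<ge> 1"
    and ks: "\<And>j. j < m \<Longrightarrow> ks j \<in> set_pmf D"
    and likely: "real (card {j. j < m \<and> 1 / T \<le> pmf D (ks j)}) \<ge> c * real m"
    and le: "4 * T \<le> B"
  shows "mkg_succeeds_within D g c m B ks"
proof -
  have "{j. j < m \<and> 1 / T \<le> pmf D (ks j)} \<subseteq> {j. j < m \<and> (\<exists>i\<ge>1. real i \<le> T \<and> g i = ks j)}"
    using is_get_key_index_le[OF g fin] T by auto
  then have "card {j. j < m \<and> 1 / T \<le> pmf D (ks j)} \<le> card {j. j < m \<and> (\<exists>i\<ge>1. real i \<le> T \<and> g i = ks j)}"
    by (intro card_mono) auto
  with likely have "real (card {j. j < m \<and> (\<exists>i\<ge>1. real i \<le> T \<and> g i = ks j)}) \<ge> c * real m"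
    by linarith
  from multi_key_guess_cost[OF T this] obtain ks' cost where
    run: "multi_key_guess g c m (\<lambda>j. key_oracle (ks j)) = Some (ks', cost)" and
    vals: "\<forall>j<m. ks' j \<in> {None, Some (ks j)}" and
    num: "real (card {j. j < m \<and> ks' j \<noteq> None}) \<ge> c * real m" and
    cost: "real cost \<le> 4 * T * real m"
    by blast
  \<comment> \<open>A returned key was confirmed by the oracle, so the stopping test, which counts
    answers, in fact counts correct keys.\<close>
  have "{j. j < m \<and> ks' j \<noteq> None} = {j. j < m \<and> ks' j = Some (ks j)}"
    using vals by auto
  then have "solves_multi_key (set_pmf D) c m ks ks'"
    using vals num ks unfolding solves_multi_key_def by auto
  moreover have "real cost / real m \<le> B"
  proof -
    have "real cost / real m \<le> 4 * T"
      using cost m by (simp add: field_simps)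
    then show ?thesis using le by simp
  qed
  ultimately show ?thesis
    using run unfolding mkg_succeeds_within_def by blast
qed

section \<open>Hoeffding's inequality and the random choice of the keys\<close>

lemma indep_interval_bounded_Pi_pmf:
  fixes f :: "'a \<Rightarrow> real"
  assumes "finite I" and "\<And>x. x \<in> set_pmf p \<Longrightarrow> f x \<in> {a..b}"
  shows "indep_interval_bounded_random_variables (measure_pmf (Pi_pmf I dflt (\<lambda>_. p))) I
           (\<lambda>i x. f (x i)) (\<lambda>_. a) (\<lambda>_. b)"
proof
  show "prob_space.indep_vars (measure_pmf (Pi_pmf I dflt (\<lambda>_. p))) (\<lambda>_. borel) (\<lambda>i x. f (x i)) I"
    by (rule prob_space.indep_vars_compose2[where Y = "\<lambda>_. f",
          OF measure_pmf.prob_space_axioms indep_vars_Pi_pmf[OF assms(1)]]) auto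
  show "AE x in measure_pmf (Pi_pmf I dflt (\<lambda>_. p)). f (x i) \<in> {a..b}" if "i \<in> I" for i
    using assms that by (auto simp: AE_measure_pmf_iff set_Pi_pmf PiE_dflt_def)
qed (rule assms)

text \<open>Both tails are used: the lower one for the number of likely keys among \<open>m\<close>
  samples, the upper one for the surprisal of a single key.\<close>

lemma
  fixes f :: "'a \<Rightarrow> real"
  assumes fin: "finite I" "I \<noteq> {}" and f: "\<And>x. x \<in> set_pmf p \<Longrightarrow> f x \<in> {a..b}"
    and "a < b" "\<epsilon> \<ge> 0"
  shows Pi_pmf_Hoeffding_le:
      "measure_pmf.prob (Pi_pmf I dflt (\<lambda>_. p))
         {x. (\<Sum>i\<in>I. f (x i)) \<le> real (card I) * measure_pmf.expectation p f - \<epsilon>}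
       \<le> exp (- 2 * \<epsilon>\<^sup>2 / (real (card I) * (b - a)\<^sup>2))" (is ?le)
    and Pi_pmf_Hoeffding_ge:
      "measure_pmf.prob (Pi_pmf I dflt (\<lambda>_. p))
         {x. (\<Sum>i\<in>I. f (x i)) \<ge> real (card I) * measure_pmf.expectation p f + \<epsilon>}
       \<le> exp (- 2 * \<epsilon>\<^sup>2 / (real (card I) * (b - a)\<^sup>2))" (is ?ge)
proof -
  have E: "measure_pmf.expectation (Pi_pmf I dflt (\<lambda>_. p)) (\<lambda>x. f (x i)) = measure_pmf.expectation p f"
    if "i \<in> I" for i
  proof -
    have "measure_pmf.expectation p f =
        measure_pmf.expectation (map_pmf (\<lambda>x. x i) (Pi_pmf I dflt (\<lambda>_. p))) f"
      using that fin by (simp add: Pi_pmf_component)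
    then show ?thesis by simp
  qed
  interpret X: indep_interval_bounded_random_variables "measure_pmf (Pi_pmf I dflt (\<lambda>_. p))" I
      "\<lambda>i x. f (x i)" "\<lambda>_. a" "\<lambda>_. b"
    by (rule indep_interval_bounded_Pi_pmf) (use fin f in auto)
  interpret X: Hoeffding_ineq "measure_pmf (Pi_pmf I dflt (\<lambda>_. p))" I
      "\<lambda>i x. f (x i)" "\<lambda>_. a" "\<lambda>_. b" "real (card I) * measure_pmf.expectation p f"
    by unfold_locales (simp add: E)
  have pos: "(\<Sum>i\<in>I. (b - a)\<^sup>2) > 0"
    using assms by (intro sum_pos) auto
  show ?le ?ge
    using X.Hoeffding_ineq_le[OF \<open>\<epsilon> \<ge> 0\<close> pos] X.Hoeffding_ineq_ge[OF \<open>\<epsilon> \<ge> 0\<close> pos] by simp_all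
qed

text \<open>The number of likely keys is a sum of \<open>m\<close> independent indicators with mean
  \<open>\<mu> \<ge> q > c\<close>. Unless it drops to \<open>c * m\<close>, the run succeeds within
  the cost bound.\<close>

lemma prob_mkg_succeeds_within:
  assumes g: "is_get_key D g" and fin: "finite (set_pmf D)"
    and T: "T \<ge> 1" and m: "m \<ge> 1" and B: "4 * T \<le> B"
    and q: "c < q" "q \<le> measure_pmf.prob D {k. 1 / T \<le> pmf D k}"
  shows "measure_pmf.prob (product_dist m D) {ks. mkg_succeeds_within D g c m B ks}
           \<ge> 1 - exp (- (2 * (q - c)\<^sup>2 * real m))"
proof -
  define f :: "_ \<Rightarrow> real" where "f = indicat_real {k. 1 / T \<le> pmf D k}"
  define \<mu> where "\<mu> = measure_pmf.expectation D f"
  have \<mu>: "q \<le> \<mu>"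
    using q unfolding \<mu>_def f_def by simp
  have card_eq: "(\<Sum>j<m. f (ks j)) = real (card {j. j < m \<and> 1 / T \<le> pmf D (ks j)})" for ks
    by (simp add: f_def indicator_def sum.If_cases Int_def conj_commute)
  have few: "measure_pmf.prob (product_dist m D) {ks. (\<Sum>j<m. f (ks j)) \<le> c * real m}
      \<le> exp (- (2 * (\<mu> - c)\<^sup>2 * real m))"
  proof -
    \<comment> \<open>The deviation \<open>m * (\<mu> - c)\<close> from the mean
      \<open>m * \<mu>\<close> puts the threshold exactly at \<open>c * m\<close>.\<close>
    have "measure_pmf.prob (Pi_pmf {..<m} undefined (\<lambda>_. D))
        {ks. (\<Sum>j<m. f (ks j)) \<le> real (card {..<m}) * \<mu> - real m * (\<mu> - c)}
        \<le> exp (- 2 * (real m * (\<mu> - c))\<^sup>2 / (real (card {..<m}) * (1 - 0)\<^sup>2))"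
      unfolding \<mu>_def by (rule Pi_pmf_Hoeffding_le) (use m q \<mu> in \<open>auto simp: f_def \<mu>_def lessThan_empty_iff indicator_def\<close>)
    also have "real (card {..<m}) * \<mu> - real m * (\<mu> - c) = c * real m"
      by (simp add: algebra_simps)
    also have "- 2 * (real m * (\<mu> - c))\<^sup>2 / (real (card {..<m}) * (1 - 0)\<^sup>2) = - (2 * (\<mu> - c)\<^sup>2 * real m)"
      using m by (simp add: power2_eq_square)
    finally show ?thesis
      by (simp add: product_dist_def)
  qed
  \<comment> \<open>\<open>\<mu>\<close> depends on \<open>D\<close>; the gap \<open>q - c\<close>
    gives a rate that can later be fixed for all \<open>n\<close>.\<close>
  have "1 - exp (- (2 * (q - c)\<^sup>2 * real m)) \<le> 1 - exp (- (2 * (\<mu> - c)\<^sup>2 * real m))"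
    using \<mu> q by (auto intro!: mult_right_mono power_mono)
  also have "\<dots> \<le> 1 - measure_pmf.prob (product_dist m D) {ks. (\<Sum>j<m. f (ks j)) \<le> c * real m}"
    using few by simp
  also have "\<dots> = measure_pmf.prob (product_dist m D) (- {ks. (\<Sum>j<m. f (ks j)) \<le> c * real m})"
    using measure_pmf.prob_compl[of "{ks. (\<Sum>j<m. f (ks j)) \<le> c * real m}" "product_dist m D"]
    by (simp add: Compl_eq_Diff_UNIV)
  \<comment> \<open>The inclusion is shown on the support of the sample, where every key lies in the
    key space.\<close>
  also have "\<dots> \<le> measure_pmf.prob (product_dist m D) {ks. mkg_succeeds_within D g c m B ks}"
  proof (rule measure_pmf.finite_measure_mono_AE)
    show "AE ks in product_dist m D. ks \<in> - {ks. (\<Sum>j<m. f (ks j)) \<le> c * real m} \<longrightarrow>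
        ks \<in> {ks. mkg_succeeds_within D g c m B ks}"
    proof (rule AE_pmfI, intro impI CollectI)
      fix ks assume ks: "ks \<in> set_pmf (product_dist m D)" "ks \<in> - {ks. (\<Sum>j<m. f (ks j)) \<le> c * real m}"
      show "mkg_succeeds_within D g c m B ks"
        by (rule mkg_succeeds_within_of_likely_keys[OF g fin T m _ _ B])
           (use ks in \<open>auto simp: card_eq product_dist_def set_Pi_pmf PiE_dflt_def\<close>)
    qed
  qed auto
  finally show ?thesis .
qed

section \<open>The central limit theorem for finite products\<close>

text \<open>Negation preserves the standard normal law, so both closed half-lines have equal
  measure; as they cover the line, each has at least half.\<close>

lemma std_normal_atMost_0: "measure std_normal_distribution {..0} \<ge> 1/2"
proof -
  interpret N: prob_space std_normal_distribution
    by (intro prob_space_normal_density) simp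
  have "distributed std_normal_distribution lborel (\<lambda>x. x) (\<lambda>x. ennreal (std_normal_density x))"
    unfolding distributed_def by (auto simp: distr_id2)
  from N.normal_density_affine[OF this, of "-1" 0]
  have "distributed std_normal_distribution lborel uminus (\<lambda>x. ennreal (std_normal_density x))"
    by simp
  then have d: "distr std_normal_distribution lborel uminus = std_normal_distribution"
    by (simp add: distributed_def)
  have "measure std_normal_distribution {..0} =
      measure (distr std_normal_distribution lborel uminus) {..0}"
    by (simp add: d)
  also have "\<dots> = measure std_normal_distribution {0..}"
    by (subst measure_distr) (auto intro!: arg_cong[where f = "measure _"])
  finally have eq: "measure std_normal_distribution {..0} = measure std_normal_distribution {0..}" .
  have "1 = measure std_normal_distribution ({..0} \<union> {0..})"
  proof -
    have "{..0} \<union> {0..} = (UNIV :: real set)"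
      by auto
    then show ?thesis
      using N.prob_space by simp
  qed
  also have "\<dots> \<le> measure std_normal_distribution {..0} + measure std_normal_distribution {0..}"
    by (rule measure_Un_le) auto
  finally show ?thesis using eq by simp
qed

text \<open>The law has no atoms. Continuity at 0 allows weak convergence to be evaluated
  there.\<close>

lemma isCont_cdf_std_normal: "isCont (cdf std_normal_distribution) x"
proof -
  interpret N: real_distribution std_normal_distribution
    by (rule real_dist_normal_dist)
  have "emeasure std_normal_distribution {x} = 0"
    by (subst emeasure_density) auto
  then show ?thesis
    by (simp add: N.isCont_cdf measure_def)
qed

text \<open>The library only has the central limit theorem for one infinite sequence of variables,
  so the finite products are realised as marginals of an infinite one.\<close>

lemma distr_Pi_pmf_restrict:
  assumes "finite I" "I \<noteq> {}"
  shows "distr (measure_pmf (Pi_pmf I dflt (\<lambda>_. p))) (PiM I (\<lambda>_. count_space UNIV)) (\<lambda>x. restrict x I)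
           = PiM I (\<lambda>_. measure_pmf p)"
proof -
  \<comment> \<open>Independence says that the joint law is the product of the marginals.
    \<open>restrict\<close> replaces the value \<open>dflt\<close> outside \<open>I\<close> by
    \<open>undefined\<close>, as the space of \<open>PiM\<close> demands.\<close>
  have "distr (measure_pmf (Pi_pmf I dflt (\<lambda>_. p))) (PiM I (\<lambda>_. count_space UNIV)) (\<lambda>x. \<lambda>i\<in>I. x i)
      = PiM I (\<lambda>i. distr (measure_pmf (Pi_pmf I dflt (\<lambda>_. p))) (count_space UNIV) (\<lambda>x. x i))"
    by (rule prob_space.indep_vars_iff_distr_eq_PiM'[OF measure_pmf.prob_space_axioms assms(2),
          THEN iffD1, OF _ indep_vars_Pi_pmf[OF assms(1)]]) simp
  also have "\<dots> = PiM I (\<lambda>_. measure_pmf p)"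
  proof (rule PiM_cong)
    fix i assume "i \<in> I"
    then have "map_pmf (\<lambda>x. x i) (Pi_pmf I dflt (\<lambda>_. p)) = p"
      using assms by (simp add: Pi_pmf_component)
    then show "distr (measure_pmf (Pi_pmf I dflt (\<lambda>_. p))) (count_space UNIV) (\<lambda>x. x i) = measure_pmf p"
      by (metis map_pmf_rep_eq)
  qed simp
  finally show ?thesis .
qed

text \<open>The event depends on the first \<open>n\<close> coordinates only, and both measures have
  the same image under restriction to them. \<open>n \<ge> 1\<close> makes the index set nonempty,
  as \<open>distr_Pi_pmf_restrict\<close> requires.\<close>

lemma prob_Pi_pmf_sum_le_eq:
  fixes f :: "'a \<Rightarrow> real"
  assumes "n \<ge> 1"
  shows "measure_pmf.prob (Pi_pmf {..<n} dflt (\<lambda>_. p)) {x. (\<Sum>i<n. f (x i)) \<le> s}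
           = measure (PiM UNIV (\<lambda>_::nat. measure_pmf p))
               {x \<in> space (PiM UNIV (\<lambda>_::nat. measure_pmf p)). (\<Sum>i<n. f (x i)) \<le> s}"
proof -
  interpret P: product_prob_space "\<lambda>_::nat. measure_pmf p" UNIV
    by (intro product_prob_spaceI measure_pmf.prob_space_axioms)
  let ?N = "PiM {..<n} (\<lambda>_. measure_pmf p)"
  define A where "A = {y \<in> space ?N. (\<Sum>i<n. f (y i)) \<le> s}"
  have [measurable]: "f \<in> borel_measurable (measure_pmf p)" by simp
  have A [measurable]: "A \<in> sets ?N"
    unfolding A_def by measurable
  have sets_eq: "sets (PiM {..<n} (\<lambda>_. count_space UNIV :: 'a measure)) = sets ?N"
    by (intro sets_PiM_cong) auto
  have spc: "space ?N = PiE {..<n} (\<lambda>_. UNIV)"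
    by (simp add: space_PiM)
  have "measure_pmf.prob (Pi_pmf {..<n} dflt (\<lambda>_. p)) {x. (\<Sum>i<n. f (x i)) \<le> s}
      = measure (distr (measure_pmf (Pi_pmf {..<n} dflt (\<lambda>_. p)))
          (PiM {..<n} (\<lambda>_. count_space UNIV)) (\<lambda>x. restrict x {..<n})) A"
    using A sets_eq
    by (subst measure_distr) (auto simp: A_def spc space_PiM intro!: arg_cong[where f = "measure _"])
  also have "\<dots> = measure ?N A"
    using assms by (subst distr_Pi_pmf_restrict) (auto simp: lessThan_empty_iff)
  also have "\<dots> = measure (distr (PiM UNIV (\<lambda>_::nat. measure_pmf p)) ?N (\<lambda>x. restrict x {..<n})) A"
    by (subst P.distr_PiM_restrict_finite) auto
  also have "\<dots> = measure (PiM UNIV (\<lambda>_::nat. measure_pmf p))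
      {x \<in> space (PiM UNIV (\<lambda>_::nat. measure_pmf p)). (\<Sum>i<n. f (x i)) \<le> s}"
    by (subst measure_distr[OF _ A])
       (auto simp: A_def spc space_PiM intro!: measurable_restrict_subset arg_cong[where f = "measure _"])
  finally show ?thesis .
qed

text \<open>The sum is at most its mean iff the standardised sum is at most 0, which in the limit
  has probability at least 1/2.\<close>

lemma eventually_prob_sum_le_mean:
  fixes f :: "'a \<Rightarrow> real"
  assumes fin: "finite (set_pmf p)" and q: "q < 1/2"
  shows "eventually (\<lambda>n. q \<le> measure_pmf.prob (Pi_pmf {..<n} dflt (\<lambda>_. p))
           {x. (\<Sum>i<n. f (x i)) \<le> real n * measure_pmf.expectation p f}) sequentially"
proof -
  define \<mu> where "\<mu> = measure_pmf.expectation p f"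
  define \<sigma> where "\<sigma> = sqrt (measure_pmf.variance p f)"
  have \<sigma>: "\<sigma> \<ge> 0" "\<sigma>\<^sup>2 = measure_pmf.variance p f"
    by (auto simp: \<sigma>_def)
  have int [simp, intro]: "integrable (measure_pmf p) h" for h :: "'a \<Rightarrow> real"
    by (rule integrable_measure_pmf_finite[OF fin])
  show ?thesis
  proof (cases "\<sigma> = 0")
    case True
    \<comment> \<open>Standardising requires positive variance. With variance 0, \<open>f\<close>
      equals its mean on the support and the event is certain.\<close>
    have "AE x in measure_pmf p. (f x - \<mu>)\<^sup>2 = 0"
      using \<sigma> True by (subst integral_nonneg_eq_0_iff_AE[symmetric]) (auto simp: \<mu>_def)
    then have "f x = \<mu>" if "x \<in> set_pmf p" for x
      using that by (simp add: AE_measure_pmf_iff)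
    then have "measure_pmf.prob (Pi_pmf {..<n} dflt (\<lambda>_. p)) {x. (\<Sum>i<n. f (x i)) \<le> real n * \<mu>} = 1" for n
      by (subst measure_pmf.prob_eq_1) (auto simp: AE_measure_pmf_iff set_Pi_pmf PiE_dflt_def)
    then show ?thesis
      using q by (simp add: \<mu>_def)
  next
    case False
    with \<sigma> have "\<sigma> > 0" by simp
    let ?M = "PiM UNIV (\<lambda>_::nat. measure_pmf p)"
    interpret P: product_prob_space "\<lambda>_::nat. measure_pmf p" UNIV
      by (intro product_prob_spaceI measure_pmf.prob_space_axioms)
    have [measurable]: "f \<in> borel_measurable (measure_pmf p)" by simp
    have comp: "distr ?M (measure_pmf p) (\<lambda>\<omega>. \<omega> i) = measure_pmf p" for i
      by (rule P.PiM_component) simp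
    have meas [measurable]: "(\<lambda>\<omega>. h (\<omega> i)) \<in> borel_measurable ?M" for h :: "'a \<Rightarrow> real" and i
      by (rule measurable_compose[OF measurable_component_singleton]) auto
    have E: "P.expectation (\<lambda>\<omega>. h (\<omega> i)) = measure_pmf.expectation p h" for h :: "'a \<Rightarrow> real" and i
      by (subst (2) comp[of i, symmetric], subst integral_distr) auto
    have I: "integrable ?M (\<lambda>\<omega>. h (\<omega> i))" for h :: "'a \<Rightarrow> real" and i
    proof -
      have "integrable (distr ?M (measure_pmf p) (\<lambda>\<omega>. \<omega> i)) h"
        unfolding comp by auto
      then show ?thesis
        by (subst (asm) integrable_distr_eq) auto
    qed
    \<comment> \<open>The joint law of the coordinates is the product measure itself.\<close>
    have indep: "P.indep_vars (\<lambda>_. measure_pmf p) (\<lambda>i \<omega>. \<omega> i) UNIV"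
      by (subst P.indep_vars_iff_distr_eq_PiM') (auto simp: comp distr_id2 restrict_UNIV)
    have "weak_conv_m (\<lambda>n. distr ?M borel (\<lambda>x. (\<Sum>i<n. f (x i) - \<mu>) / sqrt (real n * \<sigma>\<^sup>2)))
        std_normal_distribution"
    proof (rule P.central_limit_theorem[where X = "\<lambda>i \<omega>. f (\<omega> i)" and \<mu> = "distr (measure_pmf p) borel f"])
      show "P.indep_vars (\<lambda>_. borel) (\<lambda>i \<omega>. f (\<omega> i)) UNIV"
        by (rule P.indep_vars_compose2[OF indep]) auto
      show "P.expectation (\<lambda>\<omega>. f (\<omega> n)) = \<mu>" for n
        by (simp add: E \<mu>_def)
      show "P.variance (\<lambda>\<omega>. f (\<omega> n)) = \<sigma>\<^sup>2" for n
        using E[of "\<lambda>a. (f a - \<mu>)\<^sup>2" n] by (simp add: E \<mu>_def \<sigma>)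
      show "integrable ?M (\<lambda>\<omega>. (f (\<omega> n))\<^sup>2)" for n
        using I[of "\<lambda>a. (f a)\<^sup>2" n] .
      show "distr ?M borel (\<lambda>\<omega>. f (\<omega> n)) = distr (measure_pmf p) borel f" for n
        by (subst (2) comp[of n, symmetric], subst distr_distr) (auto simp: comp_def)
    qed (use \<open>\<sigma> > 0\<close> in auto)
    then have "(\<lambda>n. cdf (distr ?M borel (\<lambda>x. (\<Sum>i<n. f (x i) - \<mu>) / sqrt (real n * \<sigma>\<^sup>2))) 0)
        \<longlonglongrightarrow> cdf std_normal_distribution 0"
      using isCont_cdf_std_normal unfolding weak_conv_m_def weak_conv_def by blast
    moreover have "q < cdf std_normal_distribution 0"
      using q std_normal_atMost_0 by (simp add: cdf_def)
    ultimately have "eventually (\<lambda>n. q < cdf (distr ?M borel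
        (\<lambda>x. (\<Sum>i<n. f (x i) - \<mu>) / sqrt (real n * \<sigma>\<^sup>2))) 0) sequentially"
      by (rule order_tendstoD)
    with eventually_ge_at_top[of 1] show ?thesis
    proof eventually_elim
      case (elim n)
      have "sqrt (real n * \<sigma>\<^sup>2) > 0"
        using elim \<open>\<sigma> > 0\<close> by simp
      then have "(\<Sum>i<n. f (x i) - \<mu>) / sqrt (real n * \<sigma>\<^sup>2) \<le> 0 \<longleftrightarrow> (\<Sum>i<n. f (x i)) \<le> real n * \<mu>" for x
        by (simp add: divide_le_0_iff sum_subtractf not_le[symmetric] del: real_sqrt_gt_0_iff real_sqrt_le_0_iff)
      then have "cdf (distr ?M borel (\<lambda>x. (\<Sum>i<n. f (x i) - \<mu>) / sqrt (real n * \<sigma>\<^sup>2))) 0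
          = measure ?M {x \<in> space ?M. (\<Sum>i<n. f (x i)) \<le> real n * \<mu>}"
        unfolding cdf_def by (subst measure_distr) (auto intro!: arg_cong[where f = "measure _"])
      with elim show ?case
        using prob_Pi_pmf_sum_le_eq[of n dflt p f "real n * \<mu>"] by (simp add: \<mu>_def)
    qed
  qed
qed

section \<open>Surprisal and likely keys of the product distribution\<close>

text \<open>Makes the entropy the mean to which Hoeffding's inequality and the limit theorem
  refer.\<close>

lemma shannon_entropy_eq_expectation:
  assumes "finite (set_pmf chi)"
  shows "shannon_entropy chi = measure_pmf.expectation chi (\<lambda>a. - log 2 (pmf chi a))"
  using assms
  by (subst integral_measure_pmf_real[of "set_pmf chi"])
     (auto simp: shannon_entropy_def sum_negf mult.commute)

text \<open>Taking logarithms turns the product of letter probabilities into a sum; on the support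
  all factors are positive.\<close>

lemma pmf_product_dist_ge_iff:
  assumes "x \<in> set_pmf (product_dist n chi)"
  shows "1 / 2 powr s \<le> pmf (product_dist n chi) x \<longleftrightarrow> (\<Sum>i<n. - log 2 (pmf chi (x i))) \<le> s"
proof -
  have x: "pmf chi (x i) > 0" if "i < n" for i
    using assms that by (auto simp: product_dist_def set_Pi_pmf PiE_dflt_def pmf_positive_iff)
  have "pmf (product_dist n chi) x = (\<Prod>i<n. pmf chi (x i))"
    using assms set_Pi_pmf_subset[of "{..<n}" undefined "\<lambda>_. chi"]
    by (auto simp: product_dist_def pmf_Pi)
  also have "\<dots> = 2 powr (\<Sum>i<n. log 2 (pmf chi (x i)))"
    using x by (simp add: powr_sum)
  finally show ?thesis
    by (simp add: powr_minus_divide[symmetric] sum_negf minus_le_iff)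
qed

lemma prob_product_dist_likely:
  "measure_pmf.prob (product_dist n chi) {k. 1 / 2 powr s \<le> pmf (product_dist n chi) k}
   = measure_pmf.prob (product_dist n chi) {x. (\<Sum>i<n. - log 2 (pmf chi (x i))) \<le> s}"
  by (rule measure_pmf.finite_measure_eq_AE)
     (auto intro!: AE_pmfI simp: pmf_product_dist_ge_iff)

lemma finite_set_product_dist:
  "finite (set_pmf chi) \<Longrightarrow> finite (set_pmf (product_dist n chi))"
  by (auto simp: product_dist_def set_Pi_pmf)

lemma surprisal_bounds:
  assumes "finite (set_pmf chi)"
  obtains L where "L > 0" "\<And>a. a \<in> set_pmf chi \<Longrightarrow> - log 2 (pmf chi a) \<in> {0..L}"
proof
  have nonneg: "- log 2 (pmf chi a) \<ge> 0" if "a \<in> set_pmf chi" for a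
    using that by (simp add: pmf_le_1 pmf_positive_iff)
  \<comment> \<open>Each surprisal is at most the finite sum of all of them. The extra 1 keeps the
    interval nondegenerate even for a point mass, as \<open>a < b\<close> in Hoeffding's inequality
    demands.\<close>
  show "(1 + (\<Sum>a\<in>set_pmf chi. - log 2 (pmf chi a))) > 0"
    using nonneg by (intro add_pos_nonneg sum_nonneg) auto
  show "- log 2 (pmf chi a) \<in> {0..1 + (\<Sum>a\<in>set_pmf chi. - log 2 (pmf chi a))}" if "a \<in> set_pmf chi" for a
    using member_le_sum[of a "set_pmf chi" "\<lambda>a. - log 2 (pmf chi a)"] that nonneg assms by fastforce
qed

lemma shannon_entropy_nonneg:
  assumes "finite (set_pmf chi)"
  shows "shannon_entropy chi \<ge> 0"
  unfolding shannon_entropy_eq_expectation[OF assms]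
  by (rule integral_nonneg_AE) (auto intro!: AE_pmfI simp: pmf_le_1 pmf_positive_iff)

text \<open>A sum of \<open>n\<close> bounded independent surprisals exceeds its mean by more than a
  multiple of \<open>sqrt n\<close> only with small probability, uniformly in
  \<open>n\<close>.\<close>

lemma prob_likely_sqrt_slack:
  assumes fin: "finite (set_pmf chi)" and q: "0 < q" "q < 1"
  obtains b where "b \<ge> 0"
    "\<And>n. n \<ge> 1 \<Longrightarrow> q \<le> measure_pmf.prob (product_dist n chi)
       {k. 1 / 2 powr (shannon_entropy chi * real n + b * sqrt (real n)) \<le> pmf (product_dist n chi) k}"
proof -
  obtain L where L: "L > 0" "\<And>a. a \<in> set_pmf chi \<Longrightarrow> - log 2 (pmf chi a) \<in> {0..L}"
    using surprisal_bounds[OF fin] by blast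
  \<comment> \<open>Chosen so that \<open>exp (- 2 * b\<^sup>2 / L\<^sup>2) = 1 - q\<close>; the
    factor \<open>n\<close> cancels in Hoeffding's bound.\<close>
  define b where "b = L * sqrt (- ln (1 - q) / 2)"
  have ln: "- ln (1 - q) \<ge> 0"
    using q by simp
  have b: "b \<ge> 0" "b\<^sup>2 = L\<^sup>2 * (- ln (1 - q) / 2)"
    using L ln by (auto simp: b_def power_mult_distrib)
  show ?thesis
  proof
    show "b \<ge> 0" by (rule b)
    fix n :: nat assume n: "n \<ge> 1"
    let ?D = "product_dist n chi" and ?s = "shannon_entropy chi * real n + b * sqrt (real n)"
    let ?A = "{x. (\<Sum>i<n. - log 2 (pmf chi (x i))) \<ge> ?s}"
    have "measure_pmf.prob (Pi_pmf {..<n} undefined (\<lambda>_. chi))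
        {x. (\<Sum>i<n. - log 2 (pmf chi (x i))) \<ge> real (card {..<n}) *
           measure_pmf.expectation chi (\<lambda>a. - log 2 (pmf chi a)) + b * sqrt (real n)}
        \<le> exp (- 2 * (b * sqrt (real n))\<^sup>2 / (real (card {..<n}) * (L - 0)\<^sup>2))"
      by (rule Pi_pmf_Hoeffding_ge) (use n L b in \<open>auto simp: lessThan_empty_iff\<close>)
    also have "- 2 * (b * sqrt (real n))\<^sup>2 / (real (card {..<n}) * (L - 0)\<^sup>2) = ln (1 - q)"
      using n L by (simp add: power_mult_distrib b)
    finally have "measure_pmf.prob ?D ?A \<le> 1 - q"
      using q by (simp add: product_dist_def shannon_entropy_eq_expectation[OF fin] mult.commute)
    then have "q \<le> 1 - measure_pmf.prob ?D ?A"
      by simp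
    also have "\<dots> = measure_pmf.prob ?D (- ?A)"
      using measure_pmf.prob_compl[of ?A ?D] by (simp add: Compl_eq_Diff_UNIV)
    also have "\<dots> \<le> measure_pmf.prob ?D {x. (\<Sum>i<n. - log 2 (pmf chi (x i))) \<le> ?s}"
      by (rule measure_pmf.finite_measure_mono) auto
    finally show "q \<le> measure_pmf.prob ?D {k. 1 / 2 powr ?s \<le> pmf ?D k}"
      unfolding prob_product_dist_likely .
  qed
qed

text \<open>From some \<open>N\<close> on the limit theorem gives the bound without slack; the
  finitely many smaller \<open>n\<close> are covered by a constant.\<close>

lemma prob_likely_const_slack:
  assumes fin: "finite (set_pmf chi)" and q: "q < 1/2"
  obtains a where "a \<ge> 0"
    "\<And>n. q \<le> measure_pmf.prob (product_dist n chi)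
       {k. 1 / 2 powr (shannon_entropy chi * real n + a) \<le> pmf (product_dist n chi) k}"
proof -
  obtain L where L: "L > 0" "\<And>a. a \<in> set_pmf chi \<Longrightarrow> - log 2 (pmf chi a) \<in> {0..L}"
    using surprisal_bounds[OF fin] by blast
  obtain N where N: "\<And>n. n \<ge> N \<Longrightarrow> q \<le> measure_pmf.prob (product_dist n chi)
      {x. (\<Sum>i<n. - log 2 (pmf chi (x i))) \<le> real n * shannon_entropy chi}"
    using eventually_prob_sum_le_mean[OF fin q, of undefined "\<lambda>a. - log 2 (pmf chi a)"]
    unfolding eventually_sequentially product_dist_def shannon_entropy_eq_expectation[OF fin] by blast
  show ?thesis
  proof
    \<comment> \<open>For \<open>n < N\<close> the total surprisal is at most
      \<open>n * L \<le> N * L\<close>, so with slack \<open>N * L\<close> every key of the support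
      is likely.\<close>
    show "real N * L \<ge> 0" using L by simp
    fix n :: nat
    let ?D = "product_dist n chi" and ?s = "shannon_entropy chi * real n + real N * L"
    have "q \<le> measure_pmf.prob ?D {x. (\<Sum>i<n. - log 2 (pmf chi (x i))) \<le> ?s}"
    proof (cases "n \<ge> N")
      case True
      have "measure_pmf.prob ?D {x. (\<Sum>i<n. - log 2 (pmf chi (x i))) \<le> real n * shannon_entropy chi}
          \<le> measure_pmf.prob ?D {x. (\<Sum>i<n. - log 2 (pmf chi (x i))) \<le> ?s}"
        using \<open>real N * L \<ge> 0\<close> by (intro measure_pmf.finite_measure_mono) (auto simp: mult.commute)
      then show ?thesis using N[OF True] by simp
    next
      case False
      have "(\<Sum>i<n. - log 2 (pmf chi (x i))) \<le> ?s" if "x \<in> set_pmf ?D" for x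
      proof -
        have "(\<Sum>i<n. - log 2 (pmf chi (x i))) \<le> (\<Sum>i<n. L)"
          using that L by (intro sum_mono) (auto simp: product_dist_def set_Pi_pmf PiE_dflt_def)
        also have "\<dots> \<le> real N * L"
          using False L by simp
        also have "\<dots> \<le> ?s"
          using shannon_entropy_nonneg[OF fin] by simp
        finally show ?thesis .
      qed
      then have "measure_pmf.prob ?D {x. (\<Sum>i<n. - log 2 (pmf chi (x i))) \<le> ?s} = 1"
        by (subst measure_pmf.prob_eq_1) (auto simp: AE_measure_pmf_iff)
      then show ?thesis using q by simp
    qed
    then show "q \<le> measure_pmf.prob ?D {k. 1 / 2 powr ?s \<le> pmf ?D k}"
      unfolding prob_product_dist_likely .
  qed
qed

section \<open>Choice of constants for the two cost bounds\<close>

theorem theorem3p4: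
  fixes chi :: "'a pmf" and c :: real
  assumes "finite (set_pmf chi)" and "0 < c" and "c < 1"
  shows "(c < 1/2 \<longrightarrow>
      (\<exists>(C::real) (d::nat) (\<gamma>::real). \<gamma> > 0 \<and> (\<forall>n\<ge>1. \<forall>m\<ge>1. \<forall>getkey.
         is_get_key (product_dist n chi) getkey \<longrightarrow>
         measure_pmf.prob (product_dist m (product_dist n chi))
           {ks. mkg_succeeds_within (product_dist n chi) getkey c m
                  (C * real n ^ d * 2 powr (shannon_entropy chi * real n)) ks}
         \<ge> 1 - exp (- (\<gamma> * real m)))))
    \<and> (1/2 \<le> c \<longrightarrow>
      (\<exists>(C::real) (\<gamma>::real). \<gamma> > 0 \<and> (\<forall>n\<ge>1. \<forall>m\<ge>1. \<forall>getkey.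
         is_get_key (product_dist n chi) getkey \<longrightarrow>
         measure_pmf.prob (product_dist m (product_dist n chi))
           {ks. mkg_succeeds_within (product_dist n chi) getkey c m
                  (2 powr (shannon_entropy chi * real n + C * sqrt (real n))) ks}
         \<ge> 1 - exp (- (\<gamma> * real m)))))"
proof (intro conjI impI)
  note H = shannon_entropy_nonneg[OF assms(1)]
  assume "c < 1/2"
  \<comment> \<open>The midpoint leaves room on both sides: \<open>q < 1/2\<close> for the limit
    theorem, and a constant gap \<open>q - c\<close> for the exponential rate.\<close>
  define q where "q = (c + 1/2) / 2"
  have q: "c < q" "q < 1/2" using \<open>c < 1/2\<close> by (auto simp: q_def)
  obtain a where a: "a \<ge> 0" and likely: "\<And>n. q \<le> measure_pmf.prob (product_dist n chi)
       {k. 1 / 2 powr (shannon_entropy chi * real n + a) \<le> pmf (product_dist n chi) k}"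
    using prob_likely_const_slack[OF assms(1) q(2)] by blast
  show "\<exists>(C::real) (d::nat) (\<gamma>::real). \<gamma> > 0 \<and> (\<forall>n\<ge>1. \<forall>m\<ge>1. \<forall>getkey.
         is_get_key (product_dist n chi) getkey \<longrightarrow>
         measure_pmf.prob (product_dist m (product_dist n chi))
           {ks. mkg_succeeds_within (product_dist n chi) getkey c m
                  (C * real n ^ d * 2 powr (shannon_entropy chi * real n)) ks}
         \<ge> 1 - exp (- (\<gamma> * real m)))"
  \<comment> \<open>The 4 is the factor of the cost bound \<open>4 * T\<close>, and
    \<open>2 powr a\<close> comes from the constant slack; degree 0 makes the polynomial factor
    1.\<close>
  proof (rule exI[of _ "4 * 2 powr a"], rule exI[of _ 0], rule exI[of _ "2 * (q - c)\<^sup>2"],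
      intro conjI allI impI)
    fix n m :: nat and g assume *: "n \<ge> 1" "m \<ge> 1" "is_get_key (product_dist n chi) g"
    have "1 \<le> 2 powr (shannon_entropy chi * real n + a)"
      using a H by (intro ge_one_powr_ge_zero) auto
    with * show "1 - exp (- (2 * (q - c)\<^sup>2 * real m)) \<le>
        measure_pmf.prob (product_dist m (product_dist n chi))
           {ks. mkg_succeeds_within (product_dist n chi) g c m
                  (4 * 2 powr a * real n ^ 0 * 2 powr (shannon_entropy chi * real n)) ks}"
      using likely[of n]
      by (intro prob_mkg_succeeds_within[OF _ finite_set_product_dist[OF assms(1)] _ _ _ q(1),
            where T = "2 powr (shannon_entropy chi * real n + a)"])
         (auto simp: powr_add)
  qed (use q in auto)
next
  note H = shannon_entropy_nonneg[OF assms(1)]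
  \<comment> \<open>Any \<open>q\<close> strictly between \<open>c\<close> and 1 is attainable with
    \<open>sqrt n\<close> slack.\<close>
  define q where "q = (c + 1) / 2"
  have q: "c < q" "0 < q" "q < 1" using assms by (auto simp: q_def)
  obtain b where b: "b \<ge> 0" and likely: "\<And>n. n \<ge> 1 \<Longrightarrow> q \<le> measure_pmf.prob (product_dist n chi)
       {k. 1 / 2 powr (shannon_entropy chi * real n + b * sqrt (real n)) \<le> pmf (product_dist n chi) k}"
    using prob_likely_sqrt_slack[OF assms(1) q(2,3)] by blast
  show "\<exists>(C::real) (\<gamma>::real). \<gamma> > 0 \<and> (\<forall>n\<ge>1. \<forall>m\<ge>1. \<forall>getkey.
         is_get_key (product_dist n chi) getkey \<longrightarrow>
         measure_pmf.prob (product_dist m (product_dist n chi))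
           {ks. mkg_succeeds_within (product_dist n chi) getkey c m
                  (2 powr (shannon_entropy chi * real n + C * sqrt (real n))) ks}
         \<ge> 1 - exp (- (\<gamma> * real m)))"
  \<comment> \<open>The factor 4 adds 2 to the exponent, and \<open>2 \<le> 2 * sqrt n\<close> for
    \<open>n \<ge> 1\<close>.\<close>
  proof (rule exI[of _ "b + 2"], rule exI[of _ "2 * (q - c)\<^sup>2"], intro conjI allI impI)
    fix n m :: nat and g assume *: "n \<ge> 1" "m \<ge> 1" "is_get_key (product_dist n chi) g"
    let ?s = "shannon_entropy chi * real n + b * sqrt (real n)"
    have "4 * 2 powr ?s = 2 powr (?s + 2)"
      by (simp add: powr_add)
    also have "\<dots> \<le> 2 powr (shannon_entropy chi * real n + (b + 2) * sqrt (real n))"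
      using *(1) by (intro powr_mono) (auto simp: algebra_simps)
    finally show "1 - exp (- (2 * (q - c)\<^sup>2 * real m)) \<le>
        measure_pmf.prob (product_dist m (product_dist n chi))
           {ks. mkg_succeeds_within (product_dist n chi) g c m
                  (2 powr (shannon_entropy chi * real n + (b + 2) * sqrt (real n))) ks}"
      using b H likely *
      by (intro prob_mkg_succeeds_within[OF *(3) finite_set_product_dist[OF assms(1)] _ _ _ q(1),
            where T = "2 powr ?s"])
         (auto intro!: ge_one_powr_ge_zero)
  qed (use q in auto)
qed

end
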